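(* Let $\Gamma$ and $\Gamma_0$ be subgroups of $\mathrm{PSL}_2(\mathbb{C})$ with $\Gamma_0\subset\Gamma$. Suppose that $\Gamma_0$ is cocompact in $\Gamma$, in the sense that there exists a compact subset $C\subset\mathrm{PSL}_2(\mathbb{C})$ such that $\Gamma=C\Gamma_0=\bigcup_{\gamma\in\Gamma_0}C\gamma$. Then $\Gamma$ satisfies the BH condition if and only if $\Gamma_0$ satisfies the BH condition.
   Context: $\hat{\mathbb{C}}$ is the Riemann sphere, on which $\mathrm{PSL}_2(\mathbb{C})$ acts by Möbius transformations. $\mathcal{K}$ denotes the set of non-empty compact subsets of $\hat{\mathbb{C}}$ with the Hausdorff distance, and $\mathcal{K}_0\subset\mathcal{K}$ is the subset of those elements that are not singletons, with the subspace topology. $\mathrm{PSL}_2(\mathbb{C})$ acts on $\mathcal{K}$ and $\mathcal{K}_0$ by $g\cdot A=g(A)$. A Jordan curve on $\hat{\mathbb{C}}$ is a simple closed curve (image of a continuous injective map $S^1\to\hat{\mathbb{C}}$), regarded as an element of $\mathcal{K}_0$. For $K\ge 1$, an orientation-preserving homeomorphism $h$ between domains of $\hat{\mathbb{C}}$ is $K$-quasiconformal if it is absolutely continuous on lines and $|h_{\bar z}|\le \frac{K-1}{K+1}|h_z|$ almost everywhere. A $K$-quasicircle is a Jordan curve which is the image of a round circle under a $K$-quasiconformal homeomorphism of $\hat{\mathbb{C}}$. A subgroup $\Gamma$ of $\mathrm{PSL}_2(\mathbb{C})$ satisfies the BH (Benoist--Hulin) condition if for every closed $\Gamma$-invariant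 subset $\mathcal{C}$ of $\mathcal{K}_0$ all of whose elements are Jordan curves, there exists $K\ge 1$ such that every element of $\mathcal{C}$ is a $K$-quasicircle. Subgroups are not assumed discrete or closed. For subsets $A,B\subset\mathrm{PSL}_2(\mathbb{C})$, $AB=\{ab\mid a\in A,\ b\in B\}$, and $C\gamma=C\{\gamma\}$. *)

theory Defs
  imports "HOL-Complex_Analysis.Complex_Analysis" "HOL-Algebra.Coset"
begin

section \<open>The Riemann sphere\<close>

datatype csphere = Fin complex | Infty

text \<open>Inverse stereographic projection onto the unit sphere of \<open>\<complex> \<times> \<real>\<close>; the metric on the
  Riemann sphere is the induced chordal metric.\<close>

fun stereo :: "csphere \<Rightarrow> complex \<times> real" where
  "stereo (Fin z) = ((2 / (1 + (cmod z)\<^sup>2)) *\<^sub>R z, ((cmod z)\<^sup>2 - 1) / ((cmod z)\<^sup>2 + 1))"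
| "stereo Infty = (0, 1)"

lemma stereo_snd_Fin: "snd (stereo (Fin z)) = 1 - 2 / (1 + (cmod z)\<^sup>2)"
proof -
  have "1 + (cmod z)\<^sup>2 \<noteq> 0" by (smt (verit) zero_le_power2)
  then show ?thesis by (simp add: field_simps)
qed

lemma inj_stereo: "inj stereo"
proof (rule injI)
  fix x y assume eq: "stereo x = stereo y"
  have pos: "1 + (cmod z)\<^sup>2 > 0" for z by (smt (verit) zero_le_power2)
  show "x = y"
  proof (cases x)
    case [simp]: (Fin z)
    show ?thesis
    proof (cases y)
      case [simp]: (Fin w)
      have "2 / (1 + (cmod z)\<^sup>2) = 2 / (1 + (cmod w)\<^sup>2)"
        using arg_cong[OF eq, of snd] stereo_snd_Fin[of z] stereo_snd_Fin[of w] by simp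
      moreover have "(2 / (1 + (cmod z)\<^sup>2)) *\<^sub>R z = (2 / (1 + (cmod w)\<^sup>2)) *\<^sub>R w"
        using eq by simp
      moreover have "2 / (1 + (cmod w)\<^sup>2) \<noteq> 0" using pos[of w] by simp
      ultimately show ?thesis by (metis Fin \<open>x = Fin z\<close> scaleR_cancel_left)
    next
      case Infty
      then show ?thesis using eq stereo_snd_Fin[of z] pos[of z] by simp
    qed
  next
    case [simp]: Infty
    show ?thesis
    proof (cases y)
      case (Fin w)
      then show ?thesis using eq stereo_snd_Fin[of w] pos[of w] by simp
    qed simp
  qed
qed

lemma norm_stereo: "norm (stereo x) = 1"
proof (cases x)
  case (Fin z)
  define t where "t = (cmod z)\<^sup>2"
  have t: "t \<ge> 0" by (simp add: t_def)
  have "(2 / (1 + t))\<^sup>2 * t + ((t - 1) / (t + 1))\<^sup>2 = (4 * t + (t - 1)\<^sup>2) / (1 + t)\<^sup>2"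
    by (simp add: power_divide add_divide_distrib add.commute)
  also have "4 * t + (t - 1)\<^sup>2 = (1 + t)\<^sup>2" by (simp add: power2_eq_square algebra_simps)
  finally have "(2 / (1 + t))\<^sup>2 * t + ((t - 1) / (t + 1))\<^sup>2 = 1" using t by simp
  then show ?thesis
    using Fin by (simp add: norm_Pair power_mult_distrib power_divide t_def)
qed (simp add: norm_Pair)

instantiation csphere :: metric_space
begin

definition dist_csphere :: "csphere \<Rightarrow> csphere \<Rightarrow> real" where
  "dist_csphere x y = dist (stereo x) (stereo y)"

definition uniformity_csphere :: "(csphere \<times> csphere) filter" where
  "uniformity_csphere = (INF e\<in>{0<..}. principal {(x, y). dist x y < e})"

definition open_csphere :: "csphere set \<Rightarrow> bool" where
  "open_csphere U \<longleftrightarrow> (\<forall>x\<in>U. eventually (\<lambda>(x', y). x' = x \<longrightarrow> y \<in> U) uniformity)"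

instance
proof
  fix x y z :: csphere
  show "dist x y = 0 \<longleftrightarrow> x = y"
    by (simp add: dist_csphere_def inj_eq[OF inj_stereo])
  show "dist x y \<le> dist x z + dist y z"
    by (simp add: dist_csphere_def dist_triangle2)
qed (simp_all add: uniformity_csphere_def open_csphere_def)

end

section \<open>The group \<open>PSL\<^sub>2(\<complex>)\<close> and its action\<close>

definition SL2C :: "(complex^2^2) monoid" where
  "SL2C = \<lparr>carrier = {A. det A = 1}, mult = (**), one = mat 1\<rparr>"

definition PSL2C :: "(complex^2^2) set monoid" where
  "PSL2C = SL2C Mod {mat 1, - mat 1}"

definition psl_class :: "complex^2^2 \<Rightarrow> (complex^2^2) set" where
  "psl_class A = {mat 1, - mat 1} #>\<^bsub>SL2C\<^esub> A"

definition quotient_topology :: "'a topology \<Rightarrow> ('a \<Rightarrow> 'b) \<Rightarrow> 'b topology" where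
  "quotient_topology X f =
     topology (\<lambda>V. V \<subseteq> f ` topspace X \<and> openin X {x \<in> topspace X. f x \<in> V})"

definition PSL2C_topology :: "(complex^2^2) set topology" where
  "PSL2C_topology = quotient_topology (top_of_set (carrier SL2C)) psl_class"

fun mobius :: "complex^2^2 \<Rightarrow> csphere \<Rightarrow> csphere" where
  "mobius A (Fin z) =
     (if A$2$1 * z + A$2$2 = 0 then Infty
      else Fin ((A$1$1 * z + A$1$2) / (A$2$1 * z + A$2$2)))"
| "mobius A Infty = (if A$2$1 = 0 then Infty else Fin (A$1$1 / A$2$1))"

text \<open>Both representatives \<open>A\<close> and \<open>- A\<close> of \<open>g\<close> define the same transformation, see
  \<open>psl_act_class\<close> below.\<close>

definition psl_act :: "(complex^2^2) set \<Rightarrow> csphere \<Rightarrow> csphere" where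
  "psl_act g z = the_elem ((\<lambda>A. mobius A z) ` g)"

lemma openin_quotient_topology:
  "openin (quotient_topology X f) V \<longleftrightarrow>
     V \<subseteq> f ` topspace X \<and> openin X {x \<in> topspace X. f x \<in> V}"
proof -
  have "istopology (\<lambda>V. V \<subseteq> f ` topspace X \<and> openin X {x \<in> topspace X. f x \<in> V})"
    unfolding istopology_def
  proof (intro conjI allI impI; (elim conjE)?)
    fix S T assume "openin X {x \<in> topspace X. f x \<in> S}" "openin X {x \<in> topspace X. f x \<in> T}"
    then have "openin X ({x \<in> topspace X. f x \<in> S} \<inter> {x \<in> topspace X. f x \<in> T})"
      by (rule openin_Int)
    then show "openin X {x \<in> topspace X. f x \<in> S \<inter> T}"
      by (rule back_subst[where P = "openin X"]) auto
  next
    fix \<U>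
    assume "\<forall>V\<in>\<U>. V \<subseteq> f ` topspace X \<and> openin X {x \<in> topspace X. f x \<in> V}"
    then have "openin X (\<Union>V\<in>\<U>. {x \<in> topspace X. f x \<in> V})" by auto
    then show "openin X {x \<in> topspace X. f x \<in> \<Union>\<U>}"
      by (rule back_subst[where P = "openin X"]) auto
  qed auto
  then show ?thesis by (simp add: quotient_topology_def topology_inverse')
qed

lemma topspace_quotient_topology: "topspace (quotient_topology X f) = f ` topspace X"
proof
  show "topspace (quotient_topology X f) \<subseteq> f ` topspace X"
    using openin_quotient_topology openin_topspace by metis
  have "{x \<in> topspace X. f x \<in> f ` topspace X} = topspace X" by auto
  then show "f ` topspace X \<subseteq> topspace (quotient_topology X f)"
    by (intro openin_subset) (simp add: openin_quotient_topology)
qed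

lemma quotient_map_quotient_topology: "quotient_map X (quotient_topology X f) f"
  by (simp add: quotient_map_def topspace_quotient_topology openin_quotient_topology)

lemma carrier_SL2C [simp]: "carrier SL2C = {A. det A = 1}"
  and mult_SL2C [simp]: "A \<otimes>\<^bsub>SL2C\<^esub> B = A ** B"
  and one_SL2C [simp]: "\<one>\<^bsub>SL2C\<^esub> = mat 1"
  by (simp_all add: SL2C_def)

lemma group_SL2C: "Group.group SL2C"
proof (rule groupI)
  fix A :: "complex^2^2" assume A: "A \<in> carrier SL2C"
  then have "invertible A" by (simp add: invertible_det_nz)
  then obtain B where B: "A ** B = mat 1" "B ** A = mat 1" by (auto simp: invertible_def)
  then have "det B * det A = 1" by (metis det_I det_mul)
  with A B show "\<exists>B\<in>carrier SL2C. B \<otimes>\<^bsub>SL2C\<^esub> A = \<one>\<^bsub>SL2C\<^esub>" by auto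
qed (auto simp: det_mul matrix_mul_assoc)

lemma det_uminus_2: "det (- A) = det (A :: complex^2^2)"
  by (simp add: det_2)

lemma mat_uminus_mult: "(- mat 1) ** A = - (A :: complex^2^2)" "A ** (- mat 1) = - A"
  by (simp_all add: vec_eq_iff matrix_matrix_mult_def mat_def sum_2 forall_2)

lemma normal_pm_one: "{mat 1, - mat 1} \<lhd> SL2C"
proof -
  interpret Group.group SL2C by (rule group_SL2C)
  have inv: "inv\<^bsub>SL2C\<^esub> (- mat 1) = - mat 1"
    by (rule inv_equality) (simp_all add: mat_uminus_mult det_uminus_2)
  have "subgroup {mat 1, - mat 1} SL2C"
    by (rule subgroupI) (use inv inv_one in \<open>auto simp: mat_uminus_mult det_uminus_2\<close>)
  then show ?thesis
    by (auto simp: normal_def normal_axioms_def group_SL2C r_coset_def l_coset_def mat_uminus_mult)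
qed

lemma group_PSL2C: "Group.group PSL2C"
  unfolding PSL2C_def by (rule normal.factorgroup_is_group[OF normal_pm_one])

lemma psl_class_eq: "psl_class A = {A, - A}"
  by (auto simp: psl_class_def r_coset_def mat_uminus_mult)

lemma carrier_PSL2C: "carrier PSL2C = psl_class ` carrier SL2C"
  by (simp add: PSL2C_def carrier_FactGroup psl_class_def)

lemma topspace_PSL2C_topology: "topspace PSL2C_topology = carrier PSL2C"
  by (simp add: PSL2C_topology_def topspace_quotient_topology carrier_PSL2C)

lemma mobius_uminus: "mobius (- A) z = mobius A z"
proof (cases z)
  case (Fin w)
  have "(- A)$2$1 * w + (- A)$2$2 = - (A$2$1 * w + A$2$2)"
    and "(- A)$1$1 * w + (- A)$1$2 = - (A$1$1 * w + A$1$2)"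
    by simp_all
  then show ?thesis
    using Fin by (simp only: mobius.simps neg_equal_0_iff_equal minus_divide_divide)
qed simp

lemma psl_act_class: "psl_act (psl_class A) z = mobius A z"
  by (simp add: psl_act_def psl_class_eq mobius_uminus)

section \<open>The spaces \<open>\<K>\<close> and \<open>\<K>\<^sub>0\<close> of compact subsets\<close>

text \<open>Total by the convention that the distance is 0 outside the non-empty bounded sets.\<close>

definition hausdist :: "'a::metric_space set \<Rightarrow> 'a set \<Rightarrow> real" where
  "hausdist A B =
     (if A \<noteq> {} \<and> bounded A \<and> B \<noteq> {} \<and> bounded B
      then max (SUP a\<in>A. infdist a B) (SUP b\<in>B. infdist b A) else 0)"

definition compacts :: "csphere set set" where
  "compacts = {A. compact A \<and> A \<noteq> {}}"

definition compacts0 :: "csphere set set" where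
  "compacts0 = {A \<in> compacts. \<not> is_singleton A}"

definition compacts_topology :: "csphere set topology" where
  "compacts_topology = Metric_space.mtopology compacts hausdist"

definition compacts0_topology :: "csphere set topology" where
  "compacts0_topology = subtopology compacts_topology compacts0"

lemma hausdist_commute: "hausdist A B = hausdist B A"
  by (auto simp: hausdist_def max.commute)

lemma infdist_le_hausdist:
  assumes "bounded A" "bounded B" "B \<noteq> {}" "a \<in> A"
  shows "infdist a B \<le> hausdist A B"
proof -
  obtain b where b: "b \<in> B" using assms by auto
  obtain e where "\<And>a. a \<in> A \<Longrightarrow> dist b a \<le> e"
    using assms(1) bounded_any_center[of A b] by auto
  then have "infdist a B \<le> e" if "a \<in> A" for a
    using infdist_le[OF b, of a] that by (force simp: dist_commute)
  then have "bdd_above ((\<lambda>a. infdist a B) ` A)" by (intro bdd_aboveI2)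
  then have "infdist a B \<le> (SUP a\<in>A. infdist a B)" using assms(4) by (rule cSUP_upper2) simp
  then show ?thesis using assms by (auto simp: hausdist_def)
qed

lemma hausdist_leI:
  assumes "A \<noteq> {}" "bounded A" "B \<noteq> {}" "bounded B"
    and "\<And>a. a \<in> A \<Longrightarrow> infdist a B \<le> r" and "\<And>b. b \<in> B \<Longrightarrow> infdist b A \<le> r"
  shows "hausdist A B \<le> r"
  using assms by (auto simp: hausdist_def intro!: cSUP_least)

lemma hausdist_nonneg: "0 \<le> hausdist A B"
proof (cases "A \<noteq> {} \<and> bounded A \<and> B \<noteq> {} \<and> bounded B")
  case True
  then obtain a where "a \<in> A" by auto
  then show ?thesis
    using infdist_le_hausdist[of A B a] infdist_nonneg[of a B] True by linarith
next
  case False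
  then have "hausdist A B = 0" unfolding hausdist_def by (simp only: if_False)
  then show ?thesis by simp
qed

lemma infdist_triangle_hausdist:
  assumes "compact A" "compact B" "compact C" "B \<noteq> {}" "C \<noteq> {}" "a \<in> A"
  shows "infdist a C \<le> hausdist A B + hausdist B C"
proof -
  obtain b where b: "b \<in> B" "\<forall>c\<in>B. dist a b \<le> dist a c"
    using continuous_attains_inf[OF assms(2,4) continuous_on_dist[OF continuous_on_const continuous_on_id]]
    by blast
  then have "dist a b \<le> infdist a B"
    using assms(4) by (auto simp: infdist_notempty intro: cINF_greatest)
  have "infdist a C \<le> infdist b C + dist a b" by (rule infdist_triangle)
  moreover have "infdist b C \<le> hausdist B C" "infdist a B \<le> hausdist A B"
    using assms b by (auto intro!: infdist_le_hausdist compact_imp_bounded)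
  ultimately show ?thesis using \<open>dist a b \<le> infdist a B\<close> by linarith
qed

lemma subset_if_hausdist_eq_0:
  assumes "compact A" "compact B" "B \<noteq> {}" "hausdist A B = 0"
  shows "A \<subseteq> B"
proof
  fix a assume "a \<in> A"
  then have "infdist a B \<le> 0"
    using infdist_le_hausdist[of A B a] assms by (simp add: compact_imp_bounded)
  then show "a \<in> B"
    using in_closed_iff_infdist_zero[OF compact_imp_closed[OF assms(2)] assms(3)] infdist_nonneg[of a B]
    by (metis order_antisym)
qed

lemma Metric_space_compacts: "Metric_space compacts hausdist"
proof
  fix A B C :: "csphere set"
  show "hausdist A B = hausdist B A" by (rule hausdist_commute)
  show "0 \<le> hausdist A B" by (rule hausdist_nonneg)
  assume AB: "A \<in> compacts" "B \<in> compacts"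
  then have A: "A \<noteq> {}" "compact A" "bounded A" and B: "B \<noteq> {}" "compact B" "bounded B"
    by (auto simp: compacts_def compact_imp_bounded)
  show "hausdist A B = 0 \<longleftrightarrow> A = B"
  proof
    assume "hausdist A B = 0"
    then show "A = B"
      using subset_if_hausdist_eq_0[of A B] subset_if_hausdist_eq_0[of B A] A B
      by (auto simp: hausdist_commute)
  next
    assume "A = B"
    then have "hausdist A B \<le> 0" using A by (intro hausdist_leI) auto
    then show "hausdist A B = 0" using hausdist_nonneg[of A B] by linarith
  qed
  assume "C \<in> compacts"
  then have C: "C \<noteq> {}" "compact C" "bounded C"
    by (auto simp: compacts_def compact_imp_bounded)
  show "hausdist A C \<le> hausdist A B + hausdist B C"
  proof (rule hausdist_leI)
    show "infdist a C \<le> hausdist A B + hausdist B C" if "a \<in> A" for a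
      using infdist_triangle_hausdist[of A B C a] that A B C by auto
    show "infdist c A \<le> hausdist A B + hausdist B C" if "c \<in> C" for c
      using infdist_triangle_hausdist[of C B A c] that A B C
      by (simp add: hausdist_commute add.commute)
  qed (use A C in auto)
qed

lemma topspace_compacts0_topology: "topspace compacts0_topology = compacts0"
  by (auto simp: compacts0_topology_def compacts_topology_def compacts0_def
      Metric_space.topspace_mtopology[OF Metric_space_compacts])

section \<open>Quasiconformal homeomorphisms and quasicircles\<close>

definition jordan_curve :: "csphere set \<Rightarrow> bool" where
  "jordan_curve J \<longleftrightarrow>
     (\<exists>f. continuous_on (sphere (0::complex) 1) f \<and> inj_on f (sphere 0 1) \<and> J = f ` sphere 0 1)"

text \<open>Absolute continuity on the interval \<open>[a, b]\<close>; a finite set of pairs \<open>(u, v)\<close> stands for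
  a family of non-overlapping intervals \<open>[u, v]\<close>.\<close>

definition abs_continuous_on :: "real \<Rightarrow> real \<Rightarrow> (real \<Rightarrow> complex) \<Rightarrow> bool" where
  "abs_continuous_on a b f \<longleftrightarrow>
     (\<forall>\<epsilon>>0. \<exists>\<delta>>0. \<forall>I. finite I \<and> (\<forall>(u, v)\<in>I. a \<le> u \<and> u \<le> v \<and> v \<le> b)
        \<and> disjoint_family_on (\<lambda>(u, v). {u<..<v}) I
        \<and> (\<Sum>(u, v)\<in>I. v - u) < \<delta>
        \<longrightarrow> (\<Sum>(u, v)\<in>I. dist (f u) (f v)) < \<epsilon>)"

text \<open>Absolute continuity on lines for maps between plane domains: in every closed rectangle
  contained in \<open>\<Omega>\<close>, absolute continuity on almost every horizontal and vertical segment.\<close>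

definition acl_on :: "complex set \<Rightarrow> (complex \<Rightarrow> complex) \<Rightarrow> bool" where
  "acl_on \<Omega> f \<longleftrightarrow>
     (\<forall>p q. cbox p q \<subseteq> \<Omega> \<longrightarrow>
        (AE y in lebesgue. y \<in> {Im p..Im q} \<longrightarrow>
           abs_continuous_on (Re p) (Re q) (\<lambda>x. f (Complex x y))) \<and>
        (AE x in lebesgue. x \<in> {Re p..Re q} \<longrightarrow>
           abs_continuous_on (Im p) (Im q) (\<lambda>y. f (Complex x y))))"

text \<open>With \<open>fx\<close>, \<open>fy\<close> the partial derivatives in the real and imaginary directions, the two
  expressions below are the Wirtinger derivatives with respect to the conjugate of \<open>z\<close> and to \<open>z\<close>.
  Their existence almost everywhere follows from absolute continuity on lines.\<close>

definition dilatation_le_on :: "real \<Rightarrow> complex set \<Rightarrow> (complex \<Rightarrow> complex) \<Rightarrow> bool" where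
  "dilatation_le_on k \<Omega> f \<longleftrightarrow>
     (AE z in lebesgue. z \<in> \<Omega> \<longrightarrow>
        (\<exists>fx fy. ((\<lambda>t. f (z + of_real t)) has_vector_derivative fx) (at 0)
               \<and> ((\<lambda>t. f (z + \<i> * of_real t)) has_vector_derivative fy) (at 0)
               \<and> cmod ((fx + \<i> * fy) / 2) \<le> k * cmod ((fx - \<i> * fy) / 2)))"

text \<open>For an injective continuous \<open>f\<close> on an open set, the winding number below is the local
  degree of \<open>f\<close> at \<open>z\<close>.\<close>

definition orientation_preserving_on :: "complex set \<Rightarrow> (complex \<Rightarrow> complex) \<Rightarrow> bool" where
  "orientation_preserving_on \<Omega> f \<longleftrightarrow>
     (\<forall>z r. r > 0 \<and> cball z r \<subseteq> \<Omega> \<longrightarrow> winding_number (f \<circ> circlepath z r) (f z) = 1)"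

text \<open>The sphere is covered by the holomorphic charts \<open>z\<close> and \<open>1 / z\<close>, which differ by \<open>inversion\<close>.
  The expressions of \<open>h\<close> in these charts are the plane parts of \<open>\<psi> \<circ> h \<circ> \<phi>\<close> for
  \<open>\<phi>, \<psi> \<in> {id, inversion}\<close>.\<close>

fun inversion :: "csphere \<Rightarrow> csphere" where
  "inversion (Fin z) = (if z = 0 then Infty else Fin (1 / z))"
| "inversion Infty = Fin 0"

definition plane_dom :: "csphere set \<Rightarrow> (csphere \<Rightarrow> csphere) \<Rightarrow> complex set" where
  "plane_dom D h = {z. Fin z \<in> D \<and> h (Fin z) \<noteq> Infty}"

definition plane_map :: "(csphere \<Rightarrow> csphere) \<Rightarrow> complex \<Rightarrow> complex" where
  "plane_map h z = (case h (Fin z) of Fin w \<Rightarrow> w | Infty \<Rightarrow> 0)"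

definition in_charts ::
  "(complex set \<Rightarrow> (complex \<Rightarrow> complex) \<Rightarrow> bool) \<Rightarrow> csphere set \<Rightarrow> (csphere \<Rightarrow> csphere) \<Rightarrow> bool" where
  "in_charts P D h \<longleftrightarrow>
     (\<forall>\<phi>\<in>{id, inversion}. \<forall>\<psi>\<in>{id, inversion}.
        P (plane_dom (\<phi> -` D) (\<psi> \<circ> h \<circ> \<phi>)) (plane_map (\<psi> \<circ> h \<circ> \<phi>)))"

definition domain_csphere :: "csphere set \<Rightarrow> bool" where
  "domain_csphere D \<longleftrightarrow> open D \<and> connected D \<and> D \<noteq> {}"

definition quasiconformal :: "real \<Rightarrow> csphere set \<Rightarrow> csphere set \<Rightarrow> (csphere \<Rightarrow> csphere) \<Rightarrow> bool" where
  "quasiconformal K D D' h \<longleftrightarrow>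
     K \<ge> 1 \<and> domain_csphere D \<and> domain_csphere D'
     \<and> (\<exists>g. homeomorphism D D' h g)
     \<and> in_charts orientation_preserving_on D h
     \<and> in_charts acl_on D h
     \<and> in_charts (dilatation_le_on ((K - 1) / (K + 1))) D h"

definition round_circle :: "csphere set \<Rightarrow> bool" where
  "round_circle S \<longleftrightarrow>
     (\<exists>c r. r > 0 \<and> S = Fin ` sphere c r) \<or>
     (\<exists>a b. b \<noteq> 0 \<and> S = insert Infty (range (\<lambda>t::real. Fin (a + of_real t * b))))"

definition quasicircle :: "real \<Rightarrow> csphere set \<Rightarrow> bool" where
  "quasicircle K J \<longleftrightarrow>
     jordan_curve J \<and> (\<exists>h S. quasiconformal K UNIV UNIV h \<and> round_circle S \<and> J = h ` S)"

section \<open>The Benoist--Hulin condition\<close>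

definition psl_invariant :: "(complex^2^2) set set \<Rightarrow> csphere set set \<Rightarrow> bool" where
  "psl_invariant \<Gamma> \<C> \<longleftrightarrow> (\<forall>g\<in>\<Gamma>. \<forall>A\<in>\<C>. psl_act g ` A \<in> \<C>)"

definition BH_condition :: "(complex^2^2) set set \<Rightarrow> bool" where
  "BH_condition \<Gamma> \<longleftrightarrow>
     (\<forall>\<C>. closedin compacts0_topology \<C> \<and> psl_invariant \<Gamma> \<C> \<and> (\<forall>J\<in>\<C>. jordan_curve J)
        \<longrightarrow> (\<exists>K\<ge>1. \<forall>J\<in>\<C>. quasicircle K J))"

end

theory Submission
  imports Defs
begin

text \<open>A set invariant under the larger group is invariant under the smaller one, so the BH condition
  passes from \<open>\<Gamma>\<^sub>0\<close> to \<open>\<Gamma>\<close>. For the converse, let \<open>\<C>\<close> be a closed \<open>\<Gamma>\<^sub>0\<close>-invariant set of Jordan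
  curves and saturate it: \<open>\<T> = \<Gamma> \<C>\<close> is a \<open>\<Gamma>\<close>-invariant set of Jordan curves that contains \<open>\<C>\<close>. If
  \<open>\<T>\<close> is closed, the BH condition for \<open>\<Gamma>\<close> gives a constant \<open>K\<close> for \<open>\<T>\<close>, which then serves for \<open>\<C>\<close>.
  Cocompactness is what makes \<open>\<T>\<close> closed. Since \<open>\<Gamma>\<^sub>0 \<C> \<subseteq> \<C>\<close>, we have \<open>\<T> = C \<Gamma>\<^sub>0 \<C> = C \<C>\<close>
  (lemma \<open>translates_by_cocompact\<close>), and the translates of a closed set by a compact set of
  transformations form a closed set (lemma \<open>closedin_compact_translates\<close>).

  The last fact needs the action on compact sets to be controlled uniformly near each
  transformation. In homogeneous coordinates the chordal distance is
  \<open>2 \<bar>v \<and> w\<bar> / (\<bar>v\<bar> \<bar>w\<bar>)\<close>, and matrices of determinant 1 preserve \<open>v \<and> w\<close>. This gives explicit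
  bounds for how much a transformation contracts distances and for how far two transformations
  are apart, and together they bound the distance of two compact sets \<open>I\<close>, \<open>J\<close> by the distance of
  \<open>A I\<close> and \<open>B J\<close> plus a multiple of \<open>\<bar>B - A\<bar>\<close> (lemma \<open>hausdist_le_hausdist_mobius\<close>).\<close>

text \<open>Power series coefficients share the symbol \<open>$\<close> with vector components, and every further
  occurrence doubles the number of readings of a formula.\<close>

no_notation fps_nth (infixl \<open>$\<close> 75)

section \<open>Homogeneous coordinates and the chordal metric\<close>

text \<open>The point of the sphere with homogeneous coordinates \<open>v\<close>; the value at \<open>0\<close> is a dummy.\<close>

definition proj :: "complex^2 \<Rightarrow> csphere" where
  "proj v = (if v$2 = 0 then Infty else Fin (v$1 / v$2))"

definition wedge :: "complex^2 \<Rightarrow> complex^2 \<Rightarrow> complex" where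
  "wedge v w = v$1 * w$2 - v$2 * w$1"

lemma vec2_eq_0_iff: "v = 0 \<longleftrightarrow> v$1 = 0 \<and> v$2 = 0" for v :: "complex^2"
  by (simp add: vec_eq_iff forall_2)

lemma norm_vec2_sq: "(norm v)\<^sup>2 = (cmod (v$1))\<^sup>2 + (cmod (v$2))\<^sup>2" for v :: "complex^2"
  by (simp add: norm_vec_def L2_set_def sum_2)

lemma obtain_homogeneous:
  obtains v where "v \<noteq> 0" "z = proj v"
proof (cases z)
  case (Fin a)
  show ?thesis
    by (rule that[of "vector [a, 1]"]) (simp_all add: Fin vec2_eq_0_iff proj_def vector_2)
next
  case Infty
  show ?thesis
    by (rule that[of "vector [1, 0]"]) (simp_all add: Infty vec2_eq_0_iff proj_def vector_2)
qed

text \<open>Clearing denominators removes the special role of the point at infinity: both coordinates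
  become quotients of homogeneous quadratic forms.\<close>

lemma stereo_proj:
  assumes "v \<noteq> 0"
  shows "stereo (proj v) = ((2 / (norm v)\<^sup>2) *\<^sub>R (v$1 * cnj (v$2)),
           ((cmod (v$1))\<^sup>2 - (cmod (v$2))\<^sup>2) / (norm v)\<^sup>2)"
proof (cases "v$2 = 0")
  case True
  with assms have "v$1 \<noteq> 0" by (simp add: vec2_eq_0_iff)
  with True show ?thesis by (simp add: proj_def norm_vec2_sq)
next
  case False
  define a b where "a = (cmod (v$1))\<^sup>2" and "b = (cmod (v$2))\<^sup>2"
  have b: "b > 0" and a: "a \<ge> 0" using False by (simp_all add: a_def b_def)
  have e: "v$1 / v$2 = (1 / b) *\<^sub>R (v$1 * cnj (v$2))"
    unfolding b_def by (subst complex_div_cnj) (simp add: scaleR_conv_of_real)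
  have n: "(cmod (v$1 / v$2))\<^sup>2 = a / b" by (simp add: a_def b_def norm_divide power_divide)
  have "2 / (1 + a / b) * (1 / b) = 2 / (a + b)" "(a / b - 1) / (a / b + 1) = (a - b) / (a + b)"
    using a b by (simp_all add: divide_simps)
  then have "stereo (Fin (v$1 / v$2)) = ((2 / (a + b)) *\<^sub>R (v$1 * cnj (v$2)), (a - b) / (a + b))"
    unfolding stereo.simps n by (subst e) (simp only: scaleR_scaleR)
  then show ?thesis using False by (simp add: proj_def norm_vec2_sq a_def b_def)
qed

text \<open>Points of the unit sphere satisfy \<open>\<bar>s - t\<bar>\<^sup>2 = 2 - 2 (s \<bullet> t)\<close>. Inserting the quadratic forms
  turns the right-hand side into \<open>4 \<bar>v \<and> w\<bar>\<^sup>2 / (\<bar>v\<bar>\<^sup>2 \<bar>w\<bar>\<^sup>2)\<close>.\<close>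

lemma dist_proj:
  assumes "v \<noteq> 0" "w \<noteq> 0"
  shows "dist (proj v) (proj w) = 2 * cmod (wedge v w) / (norm v * norm w)"
proof -
  let ?N = "(norm v)\<^sup>2 * (norm w)\<^sup>2"
  define s t where "s = stereo (proj v)" and "t = stereo (proj w)"
  have N: "norm v > 0" "norm w > 0" using assms by simp_all
  have "(dist (proj v) (proj w))\<^sup>2 = (norm (s - t))\<^sup>2"
    by (simp add: dist_csphere_def dist_norm s_def t_def)
  also have "\<dots> = 2 - 2 * (s \<bullet> t)"
    using norm_stereo[of "proj v"] norm_stereo[of "proj w"]
    by (simp add: s_def t_def power2_norm_eq_inner norm_eq_1 inner_diff_left inner_diff_right inner_commute)
  also have "s \<bullet> t = (4 * ((v$1 * cnj (v$2)) \<bullet> (w$1 * cnj (w$2)))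
      + ((cmod (v$1))\<^sup>2 - (cmod (v$2))\<^sup>2) * ((cmod (w$1))\<^sup>2 - (cmod (w$2))\<^sup>2)) / ?N"
    unfolding s_def t_def stereo_proj[OF assms(1)] stereo_proj[OF assms(2)]
    by (simp add: inner_Pair add_divide_distrib)
  also have "2 - 2 * (\<dots>) = 2 * (?N - (4 * ((v$1 * cnj (v$2)) \<bullet> (w$1 * cnj (w$2)))
      + ((cmod (v$1))\<^sup>2 - (cmod (v$2))\<^sup>2) * ((cmod (w$1))\<^sup>2 - (cmod (w$2))\<^sup>2))) / ?N"
    using N by (simp add: diff_divide_distrib right_diff_distrib)
  also have "?N - (4 * ((v$1 * cnj (v$2)) \<bullet> (w$1 * cnj (w$2)))
      + ((cmod (v$1))\<^sup>2 - (cmod (v$2))\<^sup>2) * ((cmod (w$1))\<^sup>2 - (cmod (w$2))\<^sup>2))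
      = 2 * (cmod (wedge v w))\<^sup>2"
    by (simp add: norm_vec2_sq wedge_def cmod_power2 inner_complex_def)
       (simp add: power2_eq_square algebra_simps)
  also have "2 * (2 * (cmod (wedge v w))\<^sup>2) / ?N = (2 * cmod (wedge v w) / (norm v * norm w))\<^sup>2"
    by (simp add: power_divide power_mult_distrib)
  finally show ?thesis
    by (rule power2_eq_imp_eq) simp_all
qed

lemma mobius_proj:
  assumes "det A \<noteq> 0" "v \<noteq> 0"
  shows "mobius A (proj v) = proj (A *v v)"
proof -
  have comp: "(A *v v)$1 = A$1$1 * v$1 + A$1$2 * v$2" "(A *v v)$2 = A$2$1 * v$1 + A$2$2 * v$2"
    by (simp_all add: matrix_vector_mult_def sum_2)
  show ?thesis
  proof (cases "v$2 = 0")
    case True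
    with assms(2) have "v$1 \<noteq> 0" by (simp add: vec2_eq_0_iff)
    with True show ?thesis by (simp add: proj_def comp)
  next
    case False
    then have "A$2$1 * (v$1 / v$2) + A$2$2 = (A$2$1 * v$1 + A$2$2 * v$2) / v$2"
      and "A$1$1 * (v$1 / v$2) + A$1$2 = (A$1$1 * v$1 + A$1$2 * v$2) / v$2"
      by (simp_all add: field_simps)
    with False show ?thesis by (simp add: proj_def comp del: times_divide_eq_right)
  qed
qed

lemma matrix_vector_nonzero:
  fixes A :: "complex^2^2"
  assumes "det A \<noteq> 0" "v \<noteq> 0"
  shows "A *v v \<noteq> 0"
  using assms by (metis invertible_det_nz invertible_def matrix_vector_mul_assoc
      matrix_vector_mul_lid matrix_vector_mult_0_right)

lemma mobius_mult:
  assumes "det A \<noteq> 0" "det B \<noteq> 0"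
  shows "mobius (A ** B) z = mobius A (mobius B z)"
proof -
  obtain v where "v \<noteq> 0" "z = proj v" by (rule obtain_homogeneous)
  with assms show ?thesis
    by (simp add: mobius_proj matrix_vector_nonzero det_mul matrix_vector_mul_assoc)
qed

lemma mobius_one: "mobius (mat 1) z = z"
  by (cases z) (simp_all add: mat_def)

section \<open>Metric estimates for Moebius transformations\<close>

lemma wedge_matrix_vector: "wedge (A *v v) (A *v w) = det A * wedge v w"
  by (simp add: wedge_def det_2 matrix_vector_mult_def sum_2 algebra_simps)

text \<open>After the triangle inequality this is Lagrange's identity: the squares of the two sides differ by
  the square of \<open>\<bar>v\<^sub>1\<bar> \<bar>w\<^sub>1\<bar> - \<bar>v\<^sub>2\<bar> \<bar>w\<^sub>2\<bar>\<close>.\<close>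

lemma norm_wedge_le: "cmod (wedge v w) \<le> norm v * norm w"
proof (rule power2_le_imp_le)
  define a b c d where "a = cmod (v$1)" and "b = cmod (v$2)" and "c = cmod (w$1)" and "d = cmod (w$2)"
  have "cmod (wedge v w) \<le> a * d + b * c"
    unfolding wedge_def a_def b_def c_def d_def norm_mult[symmetric] by (rule norm_triangle_ineq4)
  then have "(cmod (wedge v w))\<^sup>2 \<le> (a * d + b * c)\<^sup>2" by (rule power_mono) simp
  also have "\<dots> = (a\<^sup>2 + b\<^sup>2) * (c\<^sup>2 + d\<^sup>2) - (a * c - b * d)\<^sup>2"
    by (simp add: power2_eq_square algebra_simps)
  also have "\<dots> \<le> (norm v * norm w)\<^sup>2"
    by (simp add: power_mult_distrib norm_vec2_sq a_def b_def c_def d_def)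
  finally show "(cmod (wedge v w))\<^sup>2 \<le> (norm v * norm w)\<^sup>2" .
qed simp

text \<open>The norm of a matrix is its Frobenius norm, so the bound is the Cauchy-Schwarz inequality
  applied to each row.\<close>

lemma norm_matrix_vector_le: "norm (A *v v) \<le> norm A * norm v"
  for A :: "complex^'n^'m" and v :: "complex^'n"
proof -
  have "norm ((A *v v)$i) \<le> norm (A$i) * norm v" for i
  proof -
    have "norm ((A *v v)$i) \<le> (\<Sum>j\<in>UNIV. \<bar>norm (A$i$j)\<bar> * \<bar>norm (v$j)\<bar>)"
      by (auto simp: matrix_vector_mult_def norm_mult intro!: order_trans[OF norm_sum])
    also have "\<dots> \<le> norm (A$i) * norm v"
      unfolding norm_vec_def by (rule L2_set_mult_ineq)
    finally show ?thesis .
  qed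
  then have "norm (A *v v) \<le> L2_set (\<lambda>i. norm (A$i) * norm v) UNIV"
    unfolding norm_vec_def[of "A *v v"] by (intro L2_set_mono) simp_all
  also have "\<dots> = norm A * norm v"
    unfolding norm_vec_def[of A] by (rule L2_set_left_distrib[symmetric]) simp
  finally show ?thesis .
qed

text \<open>In dimension 2 a matrix of determinant 1 has an inverse of the same norm. Instead of computing
  the inverse, the proof tests \<open>A v\<close> against \<open>A w\<close>, where \<open>w\<close> is orthogonal to \<open>v\<close> and of equal
  norm, so that \<open>A v \<and> A w = v \<and> w\<close> has modulus \<open>\<bar>v\<bar>\<^sup>2\<close>.\<close>

lemma norm_le_norm_matrix_vector:
  fixes A :: "complex^2^2"
  assumes "det A = 1"
  shows "norm v \<le> norm A * norm (A *v v)"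
proof (cases "v = 0")
  case False
  define w :: "complex^2" where "w = vector [- cnj (v$2), cnj (v$1)]"
  have w: "norm w = norm v"
    by (rule power2_eq_imp_eq) (simp_all add: norm_vec2_sq w_def vector_2)
  have "wedge v w = of_real ((norm v)\<^sup>2)"
    unfolding wedge_def w_def norm_vec2_sq by (simp add: vector_2 complex_norm_square del: of_real_power)
  then have "(norm v)\<^sup>2 = cmod (wedge (A *v v) (A *v w))"
    by (simp add: wedge_matrix_vector assms norm_power)
  also have "\<dots> \<le> norm (A *v v) * norm (A *v w)" by (rule norm_wedge_le)
  also have "\<dots> \<le> norm (A *v v) * (norm A * norm v)"
    using norm_matrix_vector_le[of A w] by (simp add: w mult_left_mono)
  finally have "norm v * norm v \<le> (norm A * norm (A *v v)) * norm v"
    by (simp add: power2_eq_square ac_simps)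
  with False show ?thesis by simp
qed simp

text \<open>The numerator of the chordal distance is preserved, and each factor of its denominator grows
  at most by \<open>\<bar>A\<bar>\<close>.\<close>

lemma dist_le_dist_mobius:
  assumes "det A = 1"
  shows "dist x y \<le> (norm A)\<^sup>2 * dist (mobius A x) (mobius A y)"
proof -
  obtain v where v: "v \<noteq> 0" "x = proj v" by (rule obtain_homogeneous)
  obtain w where w: "w \<noteq> 0" "y = proj w" by (rule obtain_homogeneous)
  have nz: "A *v v \<noteq> 0" "A *v w \<noteq> 0" using assms v w by (simp_all add: matrix_vector_nonzero)
  have "norm (A *v v) * norm (A *v w) \<le> (norm A * norm v) * (norm A * norm w)"
    by (intro mult_mono norm_matrix_vector_le) simp_all
  then have "1 / (norm v * norm w) \<le> (norm A)\<^sup>2 / (norm (A *v v) * norm (A *v w))"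
    using v w nz by (simp add: divide_simps power2_eq_square ac_simps)
  then have "2 * cmod (wedge v w) * (1 / (norm v * norm w))
      \<le> 2 * cmod (wedge v w) * ((norm A)\<^sup>2 / (norm (A *v v) * norm (A *v w)))"
    by (intro mult_left_mono) simp_all
  then show ?thesis
    using assms v w nz by (simp add: mobius_proj dist_proj wedge_matrix_vector ac_simps)
qed

text \<open>Two transformations are uniformly close when their matrices are, because
  \<open>A v \<and> B v = (A - B) v \<and> B v\<close>. The factor \<open>\<bar>B v\<bar>\<close> cancels against the denominator of the chordal
  distance, so that only the norm of \<open>A\<close> enters; this allows \<open>A\<close> to be fixed while \<open>B\<close> varies.\<close>

lemma dist_mobius_mobius_le:
  assumes "det A = 1" "det B = 1"
  shows "dist (mobius A x) (mobius B x) \<le> 2 * norm A * norm (B - A)"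
proof -
  obtain v where v: "v \<noteq> 0" "x = proj v" by (rule obtain_homogeneous)
  have nz: "A *v v \<noteq> 0" "B *v v \<noteq> 0" using assms v by (simp_all add: matrix_vector_nonzero)
  have "wedge (A *v v) (B *v v) = wedge ((A - B) *v v) (B *v v)"
    by (simp add: wedge_def matrix_vector_mult_diff_rdistrib algebra_simps)
  then have "cmod (wedge (A *v v) (B *v v)) \<le> norm ((A - B) *v v) * norm (B *v v)"
    using norm_wedge_le[of "(A - B) *v v" "B *v v"] by simp
  also have "\<dots> \<le> (norm (A - B) * norm v) * norm (B *v v)"
    by (intro mult_right_mono norm_matrix_vector_le) simp
  also have "\<dots> \<le> (norm (A - B) * (norm A * norm (A *v v))) * norm (B *v v)"
    by (intro mult_right_mono mult_left_mono norm_le_norm_matrix_vector assms) simp_all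
  finally have "2 * cmod (wedge (A *v v) (B *v v)) / (norm (A *v v) * norm (B *v v))
      \<le> 2 * norm A * norm (A - B)"
    using nz by (simp add: divide_simps ac_simps)
  then show ?thesis
    using assms v nz by (simp add: mobius_proj dist_proj norm_minus_commute)
qed

section \<open>The action on compact sets and on Jordan curves\<close>

lemma SL2C_inverse:
  assumes "det A = 1"
  obtains B :: "complex^2^2" where "det B = 1" "\<And>z. mobius A (mobius B z) = z" "\<And>z. mobius B (mobius A z) = z"
proof -
  interpret SL: Group.group SL2C by (rule group_SL2C)
  have A: "A \<in> carrier SL2C" using assms by simp
  define B where "B = inv\<^bsub>SL2C\<^esub> A"
  have B: "det B = 1" "A ** B = mat 1" "B ** A = mat 1"
    using SL.inv_closed[OF A] SL.r_inv[OF A] SL.l_inv[OF A] by (simp_all add: B_def)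
  then have "mobius A (mobius B z) = z" "mobius B (mobius A z) = z" for z
    using assms mobius_mult[of A B z] mobius_mult[of B A z] by (simp_all add: mobius_one)
  with B(1) show ?thesis by (rule that)
qed

text \<open>The expansion bound for the inverse is a Lipschitz bound for the transformation itself.\<close>

lemma continuous_mobius:
  assumes "det A = 1"
  shows "continuous_on S (mobius A)"
proof -
  obtain B where B: "det B = 1" "\<And>z. mobius B (mobius A z) = z"
    using SL2C_inverse[OF assms] by metis
  have "((norm B)\<^sup>2)-lipschitz_on S (mobius A)"
  proof (rule lipschitz_onI)
    show "dist (mobius A x) (mobius A y) \<le> (norm B)\<^sup>2 * dist x y" for x y
      using dist_le_dist_mobius[OF B(1), of "mobius A x" "mobius A y"] by (simp add: B(2))
  qed simp
  then show ?thesis by (rule lipschitz_on_continuous_on)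
qed

lemma inj_mobius:
  assumes "det A = 1"
  shows "inj (mobius A)"
  using SL2C_inverse[OF assms] by (metis injI)

lemma mobius_image_compacts0:
  assumes "det A = 1" "J \<in> compacts0"
  shows "mobius A ` J \<in> compacts0"
proof -
  have "card (mobius A ` J) = card J"
    using inj_on_subset[OF inj_mobius[OF assms(1)] subset_UNIV] by (rule card_image)
  then show ?thesis
    using assms compact_continuous_image[OF continuous_mobius[OF assms(1)], of J]
    by (auto simp: compacts0_def compacts_def is_singleton_altdef)
qed

lemma mobius_image_jordan_curve:
  assumes "det A = 1" "jordan_curve J"
  shows "jordan_curve (mobius A ` J)"
proof -
  obtain f where f: "continuous_on (sphere (0::complex) 1) f" "inj_on f (sphere 0 1)"
      "J = f ` sphere 0 1"
    using assms(2) by (auto simp: jordan_curve_def)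
  show ?thesis unfolding jordan_curve_def
  proof (intro exI conjI)
    show "continuous_on (sphere 0 1) (mobius A \<circ> f)"
      using f(1) continuous_mobius[OF assms(1)] by (rule continuous_on_compose)
    show "inj_on (mobius A \<circ> f) (sphere 0 1)"
      using f(2) inj_on_subset[OF inj_mobius[OF assms(1)]] by (intro comp_inj_on) auto
  qed (simp add: f(3) image_comp)
qed

lemma psl_class_mult:
  assumes "det A = 1" "det B = 1"
  shows "psl_class A \<otimes>\<^bsub>PSL2C\<^esub> psl_class B = psl_class (A ** B)"
proof -
  interpret normal "{mat 1, - mat 1}" SL2C by (rule normal_pm_one)
  show ?thesis using rcos_sum[of A B] assms by (simp add: PSL2C_def psl_class_def FactGroup_def)
qed

lemma psl_act_mult:
  assumes "g \<in> carrier PSL2C" "h \<in> carrier PSL2C"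
  shows "psl_act (g \<otimes>\<^bsub>PSL2C\<^esub> h) z = psl_act g (psl_act h z)"
  using assms by (auto simp: carrier_PSL2C psl_class_mult psl_act_class mobius_mult)

lemma psl_act_one: "psl_act \<one>\<^bsub>PSL2C\<^esub> z = z"
  using psl_act_class[of "mat 1" z]
  by (simp add: PSL2C_def FactGroup_def psl_class_eq mobius_one)

section \<open>Compact families of transformations preserve closedness\<close>

text \<open>The hypothesis says that \<open>f\<close> has a Lipschitz inverse on its image; the lemma transfers the
  constant to the Hausdorff distance.\<close>

lemma hausdist_le_of_expansion:
  assumes "compact I" "I \<noteq> {}" "compact J" "J \<noteq> {}" "continuous_on UNIV f" "L \<ge> 0"
    and exp: "\<And>x y. dist x y \<le> L * dist (f x) (f y)"
  shows "hausdist I J \<le> L * hausdist (f ` I) (f ` J)"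
proof -
  have cpt: "compact (f ` S)" if "compact S" for S
    using that by (rule compact_continuous_image[OF continuous_on_subset[OF assms(5)], rotated]) simp
  have *: "infdist x T \<le> L * hausdist (f ` S) (f ` T)"
    if ST: "compact S" "compact T" "T \<noteq> {}" "x \<in> S" for x S T
  proof -
    have "infdist x T \<le> L * infdist (f x) (f ` T)"
    proof -
      have "continuous_on (f ` T) (\<lambda>q. dist (f x) q)" by (intro continuous_intros)
      then obtain y where "y \<in> T" and y: "\<And>z. z \<in> T \<Longrightarrow> dist (f x) (f y) \<le> dist (f x) (f z)"
        using continuous_attains_inf[OF cpt[OF ST(2)], of "\<lambda>q. dist (f x) q"] ST(3) by auto
      have "infdist x T \<le> dist x y" using \<open>y \<in> T\<close> by (rule infdist_le)
      also have "\<dots> \<le> L * dist (f x) (f y)" by (rule exp)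
      also have "dist (f x) (f y) \<le> infdist (f x) (f ` T)"
        using ST(3) y by (auto simp: infdist_notempty intro!: cINF_greatest)
      finally show ?thesis using assms(6) by (simp add: mult_left_mono)
    qed
    also have "\<dots> \<le> L * hausdist (f ` S) (f ` T)"
      using ST assms(6) by (intro mult_left_mono infdist_le_hausdist compact_imp_bounded cpt) auto
    finally show ?thesis .
  qed
  show ?thesis
  proof (rule hausdist_leI)
    show "infdist b I \<le> L * hausdist (f ` I) (f ` J)" if "b \<in> J" for b
      using *[of J I b] that assms(1-4) by (simp add: hausdist_commute)
  qed (use * assms(1-4) in \<open>auto intro: compact_imp_bounded\<close>)
qed

lemma hausdist_image_le:
  assumes "compact I" "I \<noteq> {}" "continuous_on I f" "continuous_on I g"
    and le: "\<And>x. x \<in> I \<Longrightarrow> dist (f x) (g x) \<le> r"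
  shows "hausdist (f ` I) (g ` I) \<le> r"
proof (rule hausdist_leI)
  show "infdist a (g ` I) \<le> r" if "a \<in> f ` I" for a
    using that le by (auto intro: infdist_le2)
  show "infdist b (f ` I) \<le> r" if "b \<in> g ` I" for b
    using that le by (auto intro!: infdist_le2 simp: dist_commute)
qed (use assms in \<open>auto intro: compact_imp_bounded compact_continuous_image\<close>)

text \<open>This inequality replaces joint continuity of \<open>(B, J) \<mapsto> B\<inverse> J\<close> at \<open>(A, A I)\<close>, with a modulus
  that depends on \<open>A\<close> alone. It follows from the two metric estimates by passing from \<open>A I\<close> to
  \<open>A J\<close> through \<open>B J\<close>.\<close>

lemma hausdist_le_hausdist_mobius:
  assumes "det A = 1" "det B = 1" "I \<in> compacts0" "J \<in> compacts0"
  shows "hausdist I J \<le> (norm A)\<^sup>2 * (hausdist (mobius A ` I) (mobius B ` J) + 2 * norm A * norm (B - A))"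
proof -
  interpret Metric_space compacts hausdist by (rule Metric_space_compacts)
  have sub: "S \<in> compacts \<and> compact S \<and> S \<noteq> {}" if "S \<in> compacts0" for S
    using that by (simp add: compacts0_def compacts_def)
  note IJ = sub[OF assms(3)] sub[OF assms(4)]
  have im: "mobius A ` I \<in> compacts" "mobius A ` J \<in> compacts" "mobius B ` J \<in> compacts"
    using assms mobius_image_compacts0 sub by blast+
  have "hausdist (mobius B ` J) (mobius A ` J) \<le> 2 * norm A * norm (B - A)"
    using IJ assms dist_mobius_mobius_le[of A B]
    by (intro hausdist_image_le continuous_mobius) (auto simp: dist_commute)
  then have "hausdist (mobius A ` I) (mobius A ` J)
      \<le> hausdist (mobius A ` I) (mobius B ` J) + 2 * norm A * norm (B - A)"
    using triangle[OF im(1) im(3) im(2)] by linarith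
  then have "(norm A)\<^sup>2 * hausdist (mobius A ` I) (mobius A ` J)
      \<le> (norm A)\<^sup>2 * (hausdist (mobius A ` I) (mobius B ` J) + 2 * norm A * norm (B - A))"
    by (rule mult_left_mono) simp
  moreover have "hausdist I J \<le> (norm A)\<^sup>2 * hausdist (mobius A ` I) (mobius A ` J)"
    using IJ assms by (intro hausdist_le_of_expansion continuous_mobius dist_le_dist_mobius) auto
  ultimately show ?thesis by linarith
qed

text \<open>The topology of \<open>\<K>\<^sub>0\<close> is that of the restricted Hausdorff metric, so closedness is a statement
  about distances.\<close>

lemma closedin_compacts0_iff:
  "closedin compacts0_topology \<C> \<longleftrightarrow>
     \<C> \<subseteq> compacts0 \<and> (\<forall>J\<in>compacts0 - \<C>. \<exists>\<epsilon>>0. \<forall>I\<in>\<C>. \<epsilon> \<le> hausdist J I)"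
proof -
  interpret K: Metric_space compacts hausdist by (rule Metric_space_compacts)
  interpret K0: Submetric compacts hausdist compacts0
    by unfold_locales (auto simp: compacts0_def)
  have eq: "compacts0_topology = K0.sub.mtopology"
    by (simp add: compacts0_topology_def compacts_topology_def K0.mtopology_submetric)
  have "closedin compacts0_topology \<C> \<longleftrightarrow>
     \<C> \<subseteq> compacts0 \<and> (\<forall>J\<in>compacts0 - \<C>. \<exists>\<epsilon>>0. disjnt \<C> (K0.sub.mball J \<epsilon>))"
    unfolding eq K0.sub.closedin_metric by blast
  also have "\<dots> \<longleftrightarrow> \<C> \<subseteq> compacts0 \<and> (\<forall>J\<in>compacts0 - \<C>. \<exists>\<epsilon>>0. \<forall>I\<in>\<C>. \<epsilon> \<le> hausdist J I)"
    by (intro conj_cong refl ball_cong ex_cong1)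
       (auto simp: disjnt_iff K0.sub.in_mball not_less dest: subsetD)
  finally show ?thesis .
qed

text \<open>These are the neighbourhoods used to cover a compact set of transformations. The preimage in
  \<open>SL\<^sub>2(\<complex>)\<close> of the image of a ball around \<open>A\<close> consists of that ball and the ball around \<open>- A\<close>.\<close>

lemma openin_psl_class_ball:
  "openin PSL2C_topology (psl_class ` {B \<in> carrier SL2C. dist A B < \<delta>})"
proof -
  let ?V = "psl_class ` {B \<in> carrier SL2C. dist A B < \<delta>}"
  have "{B \<in> carrier SL2C. psl_class B \<in> ?V} = carrier SL2C \<inter> (ball A \<delta> \<union> ball (- A) \<delta>)"
  proof (intro equalityI subsetI)
    fix B assume "B \<in> {B \<in> carrier SL2C. psl_class B \<in> ?V}"
    then obtain B' where "det B = 1" "{B, - B} = {B', - B'}" "dist A B' < \<delta>"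
      by (auto simp: psl_class_eq)
    then have "B' = B \<or> B' = - B" by blast
    then show "B \<in> carrier SL2C \<inter> (ball A \<delta> \<union> ball (- A) \<delta>)"
      using \<open>det B = 1\<close> \<open>dist A B' < \<delta>\<close> by (auto simp: dist_minus[of A "- B"] dist_norm norm_minus_commute add.commute)
  next
    fix B assume B: "B \<in> carrier SL2C \<inter> (ball A \<delta> \<union> ball (- A) \<delta>)"
    moreover have "dist (- A) B = dist A (- B)" using dist_minus[of A "- B"] by simp
    moreover have "psl_class (- B) = psl_class B" by (auto simp: psl_class_eq)
    moreover have "- B \<in> carrier SL2C" using B by (simp add: det_uminus_2)
    ultimately show "B \<in> {B \<in> carrier SL2C. psl_class B \<in> ?V}"
      by (auto intro: rev_image_eqI[of "- B"])
  qed
  moreover have "openin (top_of_set (carrier SL2C)) (carrier SL2C \<inter> (ball A \<delta> \<union> ball (- A) \<delta>))"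
    by (intro openin_open_Int open_Un open_ball)
  ultimately have "openin (top_of_set (carrier SL2C)) {B \<in> carrier SL2C. psl_class B \<in> ?V}"
    by (simp only:)
  moreover have "?V \<subseteq> psl_class ` carrier SL2C" by blast
  ultimately show ?thesis
    by (simp only: PSL2C_topology_def openin_quotient_topology topspace_euclidean_subtopology simp_thms)
qed

text \<open>Let \<open>J\<close> lie outside the set of translates. For each \<open>g \<in> C\<close> the set \<open>I = g\<inverse> J\<close> is not in \<open>\<C>\<close>,
  hence has a positive distance to \<open>\<C>\<close>; the inequality for Hausdorff distances keeps \<open>J\<close> away from
  \<open>h \<C>\<close> by a fixed amount for all \<open>h\<close> near \<open>g\<close>. Compactness of \<open>C\<close> makes this amount uniform.\<close>

lemma closedin_compact_translates:
  assumes C: "compactin PSL2C_topology C" and \<C>: "closedin compacts0_topology \<C>"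
  shows "closedin compacts0_topology {psl_act g ` I | g I. g \<in> C \<and> I \<in> \<C>}" (is "closedin _ ?T")
proof -
  have CC: "C \<subseteq> carrier PSL2C"
    using compactin_subset_topspace[OF C] by (simp add: topspace_PSL2C_topology)
  have sub: "\<C> \<subseteq> compacts0" using \<C> by (simp add: closedin_compacts0_iff)
  have act: "psl_act (psl_class A) = mobius A" for A by (rule ext) (rule psl_act_class)
  show ?thesis unfolding closedin_compacts0_iff
  proof (intro conjI ballI)
    show "?T \<subseteq> compacts0"
    proof
      fix J assume "J \<in> ?T"
      then obtain g I where gI: "g \<in> C" "I \<in> \<C>" "J = psl_act g ` I" by blast
      then obtain A where "det A = 1" "g = psl_class A" using CC by (auto simp: carrier_PSL2C)
      with gI sub show "J \<in> compacts0" by (auto simp: act intro: mobius_image_compacts0)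
    qed
  next
    fix J assume J: "J \<in> compacts0 - ?T"
    \<comment> \<open>open sets of transformations whose translates of \<open>\<C>\<close> stay uniformly away from \<open>J\<close>\<close>
    define \<U> where "\<U> = {U. openin PSL2C_topology U \<and>
      (\<exists>\<delta>>0. \<forall>h\<in>U. \<forall>I\<in>\<C>. \<delta> \<le> hausdist J (psl_act h ` I))}"
    have cover: "\<exists>U\<in>\<U>. g \<in> U" if g: "g \<in> C" for g
    proof -
      obtain A where A: "det A = 1" "g = psl_class A" using g CC by (auto simp: carrier_PSL2C)
      obtain A' where A': "det A' = 1" "\<And>z. mobius A (mobius A' z) = z"
        using SL2C_inverse[OF A(1)] by metis
      define I where "I = mobius A' ` J"
      have I: "I \<in> compacts0" "mobius A ` I = J"
        using J A' mobius_image_compacts0 by (auto simp: I_def image_image)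
      then have "I \<notin> \<C>" using J g A by (auto simp: act)
      then obtain \<epsilon> where \<epsilon>: "\<epsilon> > 0" "\<And>I'. I' \<in> \<C> \<Longrightarrow> \<epsilon> \<le> hausdist I I'"
        using \<C> I(1) unfolding closedin_compacts0_iff by blast
      \<comment> \<open>if \<open>J\<close> were \<open>\<delta>\<close>-close to some \<open>B I'\<close> with \<open>\<bar>B - A\<bar> < \<delta>\<close>, then \<open>I\<close> would have distance at most
        \<open>M \<delta>\<close> to \<open>I'\<close>; the summand 1 in \<open>\<delta>\<close> yields \<open>M \<delta> < \<epsilon>\<close> and avoids a division by zero\<close>
      define M where "M = (norm A)\<^sup>2 * (1 + 2 * norm A)"
      have M: "M \<ge> 0" by (simp add: M_def)
      define \<delta> where "\<delta> = \<epsilon> / (M + 1)"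
      have \<delta>: "\<delta> > 0" "M * \<delta> < \<epsilon>" using \<epsilon>(1) M by (simp_all add: \<delta>_def field_simps)
      define U where "U = psl_class ` {B \<in> carrier SL2C. dist A B < \<delta>}"
      have "\<delta> \<le> hausdist J (psl_act h ` I')" if h: "h \<in> U" and I': "I' \<in> \<C>" for h I'
      proof (rule ccontr)
        obtain B where B: "det B = 1" "h = psl_class B" "norm (B - A) < \<delta>"
          using h by (auto simp: U_def dist_norm norm_minus_commute)
        assume "\<not> \<delta> \<le> hausdist J (psl_act h ` I')"
        then have *: "hausdist J (mobius B ` I') < \<delta>" by (simp add: B(2) act)
        have "\<epsilon> \<le> (norm A)\<^sup>2 * (hausdist J (mobius B ` I') + 2 * norm A * norm (B - A))"
          using \<epsilon>(2)[OF I'] hausdist_le_hausdist_mobius[OF A(1) B(1) I(1), of I'] I(2) I' sub by auto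
        also have "\<dots> \<le> (norm A)\<^sup>2 * (\<delta> + 2 * norm A * \<delta>)"
          using * B(3) by (intro mult_left_mono add_mono) simp_all
        also have "\<dots> = M * \<delta>" by (simp add: M_def algebra_simps)
        finally show False using \<delta>(2) by simp
      qed
      moreover have "openin PSL2C_topology U" unfolding U_def by (rule openin_psl_class_ball)
      ultimately have "U \<in> \<U>" using \<delta>(1) unfolding \<U>_def by auto
      moreover have "g \<in> U" using A \<delta>(1) by (auto simp: U_def)
      ultimately show ?thesis by blast
    qed
    have "C \<subseteq> \<Union>\<U>" using cover by blast
    moreover have "\<forall>U\<in>\<U>. openin PSL2C_topology U" by (simp add: \<U>_def)
    ultimately obtain \<F> where \<F>: "finite \<F>" "\<F> \<subseteq> \<U>" "C \<subseteq> \<Union>\<F>"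
      using C unfolding compactin_def by metis
    have "\<exists>\<delta>>0. \<forall>U\<in>\<F>. \<forall>h\<in>U. \<forall>I\<in>\<C>. \<delta> \<le> hausdist J (psl_act h ` I)"
      using \<F>(1,2)
    proof (induction rule: finite_induct)
      case (insert U \<G>)
      then obtain d where d: "d > 0" "\<forall>U\<in>\<G>. \<forall>h\<in>U. \<forall>I\<in>\<C>. d \<le> hausdist J (psl_act h ` I)"
        by auto
      obtain e where e: "e > 0" "\<forall>h\<in>U. \<forall>I\<in>\<C>. e \<le> hausdist J (psl_act h ` I)"
        using insert.prems by (auto simp: \<U>_def)
      show ?case using d e by (intro exI[of _ "min d e"]) (auto simp: min_le_iff_disj)
    qed (auto intro: exI[of _ 1])
    then obtain \<delta> where \<delta>: "\<delta> > 0" "\<And>h I. h \<in> C \<Longrightarrow> I \<in> \<C> \<Longrightarrow> \<delta> \<le> hausdist J (psl_act h ` I)"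
      using \<F>(3) by (meson UnionE subsetD)
    show "\<exists>\<epsilon>>0. \<forall>I\<in>?T. \<epsilon> \<le> hausdist J I"
      using \<delta> by (intro exI[of _ \<delta>]) auto
  qed
qed

section \<open>Passing to a cocompact subgroup\<close>

lemma BH_condition_supergroup:
  assumes "\<Gamma>\<^sub>0 \<subseteq> \<Gamma>" "BH_condition \<Gamma>\<^sub>0"
  shows "BH_condition \<Gamma>"
proof -
  have "psl_invariant \<Gamma>\<^sub>0 \<C>" if "psl_invariant \<Gamma> \<C>" for \<C>
    using that assms(1) by (auto simp: psl_invariant_def)
  then show ?thesis using assms(2) by (simp add: BH_condition_def)
qed

text \<open>In \<open>\<Gamma> = C \<Gamma>\<^sub>0\<close> the factor from \<open>\<Gamma>\<^sub>0\<close> acts first and is absorbed by the invariant set.\<close>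

lemma translates_by_cocompact:
  assumes "subgroup \<Gamma>\<^sub>0 PSL2C" "C \<subseteq> carrier PSL2C" "\<Gamma> = C <#>\<^bsub>PSL2C\<^esub> \<Gamma>\<^sub>0"
    and inv: "psl_invariant \<Gamma>\<^sub>0 \<C>"
  shows "{psl_act g ` I | g I. g \<in> C \<and> I \<in> \<C>} = {psl_act g ` I | g I. g \<in> \<Gamma> \<and> I \<in> \<C>}"
proof -
  interpret PSL: Group.group PSL2C by (rule group_PSL2C)
  interpret \<Gamma>\<^sub>0: subgroup \<Gamma>\<^sub>0 PSL2C by (rule assms(1))
  have prod: "psl_act (c \<otimes>\<^bsub>PSL2C\<^esub> h) ` I = psl_act c ` (psl_act h ` I)"
    if "c \<in> C" "h \<in> \<Gamma>\<^sub>0" for c h I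
    using that assms(2) by (auto simp: psl_act_mult image_image subset_iff)
  have C_sub: "C \<subseteq> \<Gamma>"
  proof
    fix c assume c: "c \<in> C"
    then have "c \<otimes>\<^bsub>PSL2C\<^esub> \<one>\<^bsub>PSL2C\<^esub> = c" using assms(2) by auto
    with c show "c \<in> \<Gamma>" unfolding assms(3) set_mult_def using \<Gamma>\<^sub>0.one_closed by force
  qed
  have factor: "\<exists>c\<in>C. \<exists>I'\<in>\<C>. psl_act g ` I = psl_act c ` I'" if g: "g \<in> \<Gamma>" and I: "I \<in> \<C>" for g I
  proof -
    obtain c h where ch: "c \<in> C" "h \<in> \<Gamma>\<^sub>0" "g = c \<otimes>\<^bsub>PSL2C\<^esub> h"
      using g by (auto simp: assms(3) set_mult_def)
    then have "psl_act h ` I \<in> \<C>" using inv I by (simp add: psl_invariant_def)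
    moreover have "psl_act g ` I = psl_act c ` (psl_act h ` I)" using prod[OF ch(1,2)] ch(3) by simp
    ultimately show ?thesis using ch(1) by blast
  qed
  show ?thesis
  proof (intro equalityI subsetI)
    fix J assume "J \<in> {psl_act g ` I | g I. g \<in> \<Gamma> \<and> I \<in> \<C>}"
    then obtain g I where "g \<in> \<Gamma>" "I \<in> \<C>" "J = psl_act g ` I" by blast
    with factor[of g I] show "J \<in> {psl_act g ` I | g I. g \<in> C \<and> I \<in> \<C>}" by auto
  qed (use C_sub in blast)
qed

theorem theorem1p2:
  fixes \<Gamma> \<Gamma>\<^sub>0 :: "(complex^2^2) set set"
  assumes "subgroup \<Gamma> PSL2C"
    and "subgroup \<Gamma>\<^sub>0 PSL2C"
    and "\<Gamma>\<^sub>0 \<subseteq> \<Gamma>"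
    and "\<exists>C. compactin PSL2C_topology C \<and> \<Gamma> = C <#>\<^bsub>PSL2C\<^esub> \<Gamma>\<^sub>0"
  shows "BH_condition \<Gamma> \<longleftrightarrow> BH_condition \<Gamma>\<^sub>0"
proof
  assume BH: "BH_condition \<Gamma>"
  interpret \<Gamma>: subgroup \<Gamma> PSL2C by (rule assms(1))
  obtain C where C: "compactin PSL2C_topology C" "\<Gamma> = C <#>\<^bsub>PSL2C\<^esub> \<Gamma>\<^sub>0"
    using assms(4) by blast
  have CC: "C \<subseteq> carrier PSL2C"
    using compactin_subset_topspace[OF C(1)] by (simp add: topspace_PSL2C_topology)
  show "BH_condition \<Gamma>\<^sub>0" unfolding BH_condition_def
  proof (intro allI impI, elim conjE)
    fix \<C> assume closed: "closedin compacts0_topology \<C>" and inv: "psl_invariant \<Gamma>\<^sub>0 \<C>"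
      and jordan: "\<forall>J\<in>\<C>. jordan_curve J"
    define \<T> where "\<T> = {psl_act g ` I | g I. g \<in> \<Gamma> \<and> I \<in> \<C>}"
    have "closedin compacts0_topology \<T>"
      using closedin_compact_translates[OF C(1) closed]
      by (simp add: \<T>_def translates_by_cocompact[OF assms(2) CC C(2) inv])
    moreover have "psl_invariant \<Gamma> \<T>"
      unfolding psl_invariant_def
    proof (intro ballI)
      fix g A assume "g \<in> \<Gamma>" "A \<in> \<T>"
      then obtain h I where "h \<in> \<Gamma>" "I \<in> \<C>" "A = psl_act h ` I" by (auto simp: \<T>_def)
      moreover from this \<open>g \<in> \<Gamma>\<close> have "psl_act g ` A = psl_act (g \<otimes>\<^bsub>PSL2C\<^esub> h) ` I"
        by (simp add: psl_act_mult image_image)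
      ultimately show "psl_act g ` A \<in> \<T>" using \<open>g \<in> \<Gamma>\<close> unfolding \<T>_def by blast
    qed
    moreover have "jordan_curve J" if J: "J \<in> \<T>" for J
    proof -
      obtain g I where gI: "g \<in> \<Gamma>" "I \<in> \<C>" "J = psl_act g ` I" using J by (auto simp: \<T>_def)
      then obtain A where "det A = 1" "g = psl_class A" using \<Gamma>.mem_carrier by (auto simp: carrier_PSL2C)
      with gI jordan show ?thesis by (simp add: psl_act_class mobius_image_jordan_curve)
    qed
    ultimately obtain K where K: "K \<ge> 1" "\<forall>J\<in>\<T>. quasicircle K J"
      using BH unfolding BH_condition_def by blast
    have "\<C> \<subseteq> \<T>"
    proof
      fix I assume "I \<in> \<C>"
      moreover have "I = psl_act \<one>\<^bsub>PSL2C\<^esub> ` I" by (simp add: psl_act_one)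
      ultimately show "I \<in> \<T>" unfolding \<T>_def using \<Gamma>.one_closed by blast
    qed
    with K show "\<exists>K\<ge>1. \<forall>J\<in>\<C>. quasicircle K J" by blast
  qed
qed (rule BH_condition_supergroup[OF assms(3)])

end
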